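(* Let $E$ be a Banach lattice with the dual positive Schur property. Then, for every Banach lattice $F$, every regular operator $T \colon E \longrightarrow F$ is positively limited, hence $T^{*} \colon F^* \longrightarrow E^*$ is almost Dunford-Pettis.
   Context: Operators are linear. An operator between Banach lattices is regular if it is the difference of two positive operators. A Banach lattice $E$ has the dual positive Schur property if every positive weak$^*$-null sequence in $E^*$ is norm null. An operator $T$ from a Banach space $X$ to a Banach lattice $F$ is positively limited if $T^*$ takes positive weak$^*$-null sequences in $F^*$ to norm null sequences in $X^*$. An operator from a Banach lattice to a Banach space is almost Dunford-Pettis if it sends disjoint weakly null sequences to norm null sequences (equivalently, positive disjoint weakly null sequences to norm null sequences). *)

theory Defs
  imports "HOL-Analysis.Analysis" "HOL-Library.Lattice_Algebras"
begin

section \<open>Banach lattices\<close>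

class banach_lattice = lattice_ab_group_add_abs + ordered_real_vector + banach +
  assumes norm_le_if_abs_le: "\<bar>x\<bar> \<le> \<bar>y\<bar> \<Longrightarrow> norm x \<le> norm y"

instance real :: banach_lattice
  by standard (auto simp: sup_real_def)

lemma norm_mono_nonneg:
  fixes x y :: "'a::banach_lattice"
  assumes "0 \<le> x" "x \<le> y"
  shows "norm x \<le> norm y"
  using assms by (intro norm_le_if_abs_le) (simp add: order.trans[OF assms])

lemma norm_abs_banach_lattice [simp]: "norm \<bar>x\<bar> = norm (x::'a::banach_lattice)"
  by (intro antisym norm_le_if_abs_le) auto

section \<open>The dual Banach lattice\<close>

text \<open>
  The dual of \<open>'a\<close> is \<open>'a \<Rightarrow>\<^sub>L real\<close> with the order \<open>f \<le> g\<close> iff \<open>f x \<le> g x\<close> for all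
  \<open>x \<ge> 0\<close>. Since \<open>blinfun\<close> cannot be made an instance for the codomain \<open>real\<close> alone,
  the codomain is restricted by a class of linearly ordered complete Banach lattices;
  only the instance \<open>real\<close> is used.
\<close>

class real_line = banach_lattice + conditionally_complete_linorder

instance real :: real_line ..

lemma bdd_above_if_norm_le:
  fixes S :: "'b::real_line set"
  assumes K: "\<And>z. z \<in> S \<Longrightarrow> norm z \<le> K"
  shows "bdd_above S"
proof (cases "\<exists>z\<in>S. 0 < z")
  case False
  then show ?thesis by (intro bdd_aboveI[of _ 0]) (auto simp: not_less)
next
  case True
  then obtain z0 where z0: "z0 \<in> S" "0 < z0" by blast
  define e where "e = ((K + 1) / norm z0) *\<^sub>R z0"
  have n: "0 < norm z0" "norm z0 \<le> K" using z0 K by auto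
  then have "0 \<le> K" by linarith
  then have ne: "norm e = K + 1" using z0 by (simp add: e_def)
  have e0: "0 \<le> e" unfolding e_def using n z0 \<open>0 \<le> K\<close>
    by (intro scaleR_nonneg_nonneg divide_nonneg_nonneg) auto
  have "z \<le> e" if "z \<in> S" for z
  proof (rule ccontr)
    assume "\<not> z \<le> e"
    then have "norm e \<le> norm z" using e0 by (intro norm_mono_nonneg) auto
    then show False using K[OF that] ne by simp
  qed
  then show ?thesis by (rule bdd_aboveI)
qed

lemma norm_le_if_least:
  fixes S :: "'b::real_line set"
  assumes lub: "\<And>b. (\<And>z. z \<in> S \<Longrightarrow> z \<le> b) \<Longrightarrow> s \<le> b"
    and K: "\<And>z. z \<in> S \<Longrightarrow> norm z \<le> K" and "0 \<le> K" and s: "0 \<le> s"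
  shows "norm s \<le> K"
proof (rule ccontr)
  assume "\<not> norm s \<le> K"
  then have ns: "K < norm s" by simp
  then have s0: "0 < norm s" using \<open>0 \<le> K\<close> by linarith
  define c where "c = (K / norm s + 1) / 2"
  have c: "0 < c" "c < 1" "K < c * norm s"
    using ns s0 \<open>0 \<le> K\<close> by (auto simp: c_def field_simps intro: add_nonneg_pos)
  have "z \<le> c *\<^sub>R s" if "z \<in> S" for z
  proof (rule ccontr)
    assume "\<not> z \<le> c *\<^sub>R s"
    then have "norm (c *\<^sub>R s) \<le> norm z"
      using c s by (intro norm_mono_nonneg scaleR_nonneg_nonneg) auto
    then show False using K[OF that] c by simp
  qed
  then have "s \<le> c *\<^sub>R s" by (rule lub)
  then have "(1 - c) *\<^sub>R s \<le> 0" by (simp add: scaleR_left_diff_distrib)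
  moreover have "0 \<le> (1 - c) *\<^sub>R s" using c s by (intro scaleR_nonneg_nonneg) auto
  ultimately have "(1 - c) *\<^sub>R s = 0" by (rule antisym)
  then show False using c s0 by auto
qed

text \<open>
  Riesz--Kantorovich formula: on the positive cone, the positive part of \<open>f\<close> is
  \<open>x \<mapsto> Sup {f y | 0 \<le> y \<le> x}\<close>; \<open>blinfun_pos\<close> below is its linear extension.
\<close>

definition cone_pos :: "('a::banach_lattice \<Rightarrow>\<^sub>L 'b::real_line) \<Rightarrow> 'a \<Rightarrow> 'b"
  where "cone_pos f x = Sup (blinfun_apply f ` {0..x})"

lemma cone_pos_bdd: "bdd_above (blinfun_apply f ` {0..x})"
  for f :: "'a::banach_lattice \<Rightarrow>\<^sub>L 'b::real_line"
proof (rule bdd_above_if_norm_le[of _ "norm f * norm x"], clarsimp)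
  fix y :: 'a assume "0 \<le> y" "y \<le> x"
  then show "norm (f y) \<le> norm f * norm x"
    by (intro order.trans[OF norm_blinfun] mult_left_mono norm_mono_nonneg) auto
qed

lemma cone_pos_upper:
  "0 \<le> y \<Longrightarrow> y \<le> x \<Longrightarrow> blinfun_apply f y \<le> cone_pos f x"
  unfolding cone_pos_def by (intro cSup_upper cone_pos_bdd) auto

lemma cone_pos_least:
  "0 \<le> x \<Longrightarrow> (\<And>y. 0 \<le> y \<Longrightarrow> y \<le> x \<Longrightarrow> blinfun_apply f y \<le> b) \<Longrightarrow> cone_pos f x \<le> b"
  unfolding cone_pos_def by (rule cSup_least) auto

lemma cone_pos_nonneg: "0 \<le> x \<Longrightarrow> 0 \<le> cone_pos f x"
  using cone_pos_upper[of 0 x f] by (simp add: blinfun.zero_right)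

lemma cone_pos_0: "cone_pos f 0 = 0"
  by (intro antisym cone_pos_least cone_pos_nonneg)
     (auto dest: antisym simp: blinfun.zero_right)

lemma cone_pos_add:
  assumes x: "0 \<le> x" and y: "0 \<le> y"
  shows "cone_pos f (x + y) = cone_pos f x + cone_pos f y"
proof (rule antisym)
  show "cone_pos f (x + y) \<le> cone_pos f x + cone_pos f y"
  proof (rule cone_pos_least)
    fix z assume z: "0 \<le> z" "z \<le> x + y"
    define u where "u = inf z x"
    have u: "0 \<le> u" "u \<le> x" "u \<le> z" using x z by (auto simp: u_def)
    have "z - u = z + sup (- z) (- x)"
      by (simp add: u_def diff_conv_add_uminus neg_inf_eq_sup)
    also have "\<dots> = sup 0 (z - x)" by (simp add: add_sup_distrib_left)
    also have "\<dots> \<le> y" using y z by (simp add: diff_le_eq add.commute)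
    finally have "f (z - u) \<le> cone_pos f y" using u by (intro cone_pos_upper) auto
    moreover have "f u \<le> cone_pos f x" using u by (intro cone_pos_upper) auto
    moreover have "f z = f u + f (z - u)" by (simp add: blinfun.diff_right)
    ultimately show "f z \<le> cone_pos f x + cone_pos f y" by (simp add: add_mono)
  qed (use x y in auto)
next
  have "f u + f v \<le> cone_pos f (x + y)"
    if "0 \<le> u" "u \<le> x" "0 \<le> v" "v \<le> y" for u v
    using that cone_pos_upper[of "u + v" "x + y" f] by (simp add: blinfun.add_right add_mono)
  then have "cone_pos f x \<le> cone_pos f (x + y) - f v" if "0 \<le> v" "v \<le> y" for v
    using that x by (intro cone_pos_least) (auto simp: le_diff_eq)
  then have "cone_pos f y \<le> cone_pos f (x + y) - cone_pos f x"
    using y by (intro cone_pos_least) (auto simp: le_diff_eq algebra_simps)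
  then show "cone_pos f x + cone_pos f y \<le> cone_pos f (x + y)"
    by (simp add: le_diff_eq algebra_simps)
qed

lemma cone_pos_scaleR_le:
  assumes c: "0 < c" and x: "0 \<le> x"
  shows "cone_pos f (c *\<^sub>R x) \<le> c *\<^sub>R cone_pos f x"
proof (rule cone_pos_least)
  fix y assume y: "0 \<le> y" "y \<le> c *\<^sub>R x"
  have "inverse c *\<^sub>R y \<le> inverse c *\<^sub>R (c *\<^sub>R x)"
    using y c by (intro scaleR_left_mono) auto
  then have "f (inverse c *\<^sub>R y) \<le> cone_pos f x"
    using y c by (intro cone_pos_upper scaleR_nonneg_nonneg) auto
  then have "c *\<^sub>R f (inverse c *\<^sub>R y) \<le> c *\<^sub>R cone_pos f x"
    using c by (intro scaleR_left_mono) auto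
  then show "f y \<le> c *\<^sub>R cone_pos f x" using c by (simp add: blinfun.scaleR_right)
qed (use c x in \<open>auto intro: scaleR_nonneg_nonneg\<close>)

lemma cone_pos_scaleR:
  assumes c: "0 \<le> c" and x: "0 \<le> x"
  shows "cone_pos f (c *\<^sub>R x) = c *\<^sub>R cone_pos f x"
proof (cases "c = 0")
  case False
  with c have c: "0 < c" by simp
  have "cone_pos f (inverse c *\<^sub>R (c *\<^sub>R x)) \<le> inverse c *\<^sub>R cone_pos f (c *\<^sub>R x)"
    using c x by (intro cone_pos_scaleR_le scaleR_nonneg_nonneg) auto
  then have "c *\<^sub>R cone_pos f x \<le> c *\<^sub>R (inverse c *\<^sub>R cone_pos f (c *\<^sub>R x))"
    using c by (intro scaleR_left_mono) auto
  then show ?thesis using c x by (intro antisym cone_pos_scaleR_le) auto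
qed (simp add: cone_pos_0)

lemma cone_pos_norm:
  assumes x: "0 \<le> x"
  shows "norm (cone_pos f x) \<le> norm f * norm x"
proof (rule norm_le_if_least[of "blinfun_apply f ` {0..x}"])
  show "norm z \<le> norm f * norm x" if "z \<in> blinfun_apply f ` {0..x}" for z
    using that by (auto intro!: order.trans[OF norm_blinfun] mult_left_mono norm_mono_nonneg)
qed (use x in \<open>auto intro: cone_pos_nonneg cone_pos_least\<close>)

definition blinfun_pos :: "('a::banach_lattice \<Rightarrow>\<^sub>L 'b::real_line) \<Rightarrow> ('a \<Rightarrow>\<^sub>L 'b)"
  where "blinfun_pos f = Blinfun (\<lambda>x. cone_pos f (pprt x) - cone_pos f (- nprt x))"

lemma blinfun_pos_aux:
  fixes f :: "'a::banach_lattice \<Rightarrow>\<^sub>L 'b::real_line"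
  defines "P \<equiv> (\<lambda>x. cone_pos f (pprt x) - cone_pos f (- nprt x))"
  shows "bounded_linear P"
proof -
  have P: "P (u - v) = cone_pos f u - cone_pos f v" if "0 \<le> u" "0 \<le> v" for u v
  proof -
    have "pprt (u - v) + v = u + - nprt (u - v)"
      using prts[of "u - v"] by (simp add: algebra_simps)
    then have "cone_pos f (pprt (u - v)) + cone_pos f v
        = cone_pos f u + cone_pos f (- nprt (u - v))"
      using that by (metis cone_pos_add neg_0_le_iff_le nprt_le_zero zero_le_pprt)
    then show ?thesis by (simp add: P_def algebra_simps)
  qed
  have dec: "x = pprt x - (- nprt x)" for x :: 'a using prts[of x] by simp
  have nn: "0 \<le> pprt x" "0 \<le> - nprt x" for x :: 'a by auto
  have add: "P (x + y) = P x + P y" for x y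
  proof -
    have "x + y = (pprt x + pprt y) - (- nprt x + - nprt y)"
    proof -
      have "x + y = (pprt x + nprt x) + (pprt y + nprt y)" by (metis prts)
      then show ?thesis by (simp add: algebra_simps)
    qed
    then have "P (x + y) = cone_pos f (pprt x + pprt y) - cone_pos f (- nprt x + - nprt y)"
      by (metis P add_nonneg_nonneg nn)
    then show ?thesis unfolding P_def cone_pos_add[OF nn(1) nn(1)] cone_pos_add[OF nn(2) nn(2)]
      by (simp add: algebra_simps)
  qed
  have minus: "P (- x) = - P x" for x
    by (simp add: P_def pprt_neg nprt_neg)
  have pos: "P (c *\<^sub>R x) = c *\<^sub>R P x" if "0 \<le> c" for c x
  proof -
    have "c *\<^sub>R x = c *\<^sub>R pprt x - c *\<^sub>R (- nprt x)"
      by (metis dec scaleR_right_diff_distrib)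
    then have "P (c *\<^sub>R x) = cone_pos f (c *\<^sub>R pprt x) - cone_pos f (c *\<^sub>R (- nprt x))"
      by (metis P nn that scaleR_nonneg_nonneg)
    then show ?thesis
      using nn that
      by (simp add: P_def cone_pos_scaleR scaleR_right_diff_distrib del: scaleR_minus_right)
  qed
  have scale: "P (c *\<^sub>R x) = c *\<^sub>R P x" for c x
  proof (cases "0 \<le> c")
    case False
    then have "P ((- c) *\<^sub>R x) = (- c) *\<^sub>R P x" by (intro pos) auto
    then show ?thesis by (simp add: minus)
  qed (rule pos)
  have bnd: "norm (P x) \<le> norm x * (2 * norm f)" for x
  proof -
    have "pprt x \<le> \<bar>x\<bar>" "- nprt x \<le> \<bar>x\<bar>" by (auto simp: abs_prts)
    then have "norm (pprt x) \<le> norm x" "norm (- nprt x) \<le> norm x"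
      using norm_mono_nonneg[OF nn(1)[of x]] norm_mono_nonneg[OF nn(2)[of x]] by force+
    then have "norm (cone_pos f (pprt x)) \<le> norm f * norm x"
        "norm (cone_pos f (- nprt x)) \<le> norm f * norm x"
      by (auto intro!: order.trans[OF cone_pos_norm] mult_left_mono)
    then show ?thesis unfolding P_def by (intro order.trans[OF norm_triangle_ineq4]) (simp add: algebra_simps)
  qed
  show ?thesis using add scale bnd by (rule bounded_linear_intro)
qed

lemma blinfun_pos_apply:
  assumes "0 \<le> x"
  shows "blinfun_apply (blinfun_pos f) x = cone_pos f x"
proof -
  have "nprt x = 0" using assms by simp
  then show ?thesis
    using assms
    by (simp add: blinfun_pos_def bounded_linear_Blinfun_apply[OF blinfun_pos_aux] cone_pos_0)
qed

lemma blinfun_ext_nonneg: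
  fixes f g :: "'a::banach_lattice \<Rightarrow>\<^sub>L 'b::real_normed_vector"
  assumes "\<And>x. 0 \<le> x \<Longrightarrow> blinfun_apply f x = blinfun_apply g x"
  shows "f = g"
proof (rule blinfun_eqI)
  fix x :: 'a
  have x: "x = pprt x - (- nprt x)" using prts[of x] by simp
  have "f (pprt x) - f (- nprt x) = g (pprt x) - g (- nprt x)"
    using assms[of "pprt x"] assms[of "- nprt x"] by simp
  then show "f x = g x" by (metis x blinfun.diff_right)
qed

instantiation blinfun :: (banach_lattice, real_line) banach_lattice
begin

definition less_eq_blinfun :: "('a \<Rightarrow>\<^sub>L 'b) \<Rightarrow> ('a \<Rightarrow>\<^sub>L 'b) \<Rightarrow> bool"
  where "f \<le> g \<longleftrightarrow> (\<forall>x\<ge>0. blinfun_apply f x \<le> blinfun_apply g x)"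

definition less_blinfun :: "('a \<Rightarrow>\<^sub>L 'b) \<Rightarrow> ('a \<Rightarrow>\<^sub>L 'b) \<Rightarrow> bool"
  where "less_blinfun f g \<longleftrightarrow> f \<le> g \<and> \<not> g \<le> f"

definition sup_blinfun :: "('a \<Rightarrow>\<^sub>L 'b) \<Rightarrow> ('a \<Rightarrow>\<^sub>L 'b) \<Rightarrow> ('a \<Rightarrow>\<^sub>L 'b)"
  where "sup f g = g + blinfun_pos (f - g)"

definition inf_blinfun :: "('a \<Rightarrow>\<^sub>L 'b) \<Rightarrow> ('a \<Rightarrow>\<^sub>L 'b) \<Rightarrow> ('a \<Rightarrow>\<^sub>L 'b)"
  where "inf f g = f - blinfun_pos (f - g)"

definition abs_blinfun :: "('a \<Rightarrow>\<^sub>L 'b) \<Rightarrow> ('a \<Rightarrow>\<^sub>L 'b)"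
  where "abs_blinfun f = sup f (- f)"

instance
proof
  have pos_ge: "f \<le> blinfun_pos f" "0 \<le> blinfun_pos f" for f :: "'a \<Rightarrow>\<^sub>L 'b"
    by (auto simp: less_eq_blinfun_def blinfun_pos_apply cone_pos_nonneg intro: cone_pos_upper)
  have pos_least: "blinfun_pos f \<le> h" if "f \<le> h" "0 \<le> h" for f h :: "'a \<Rightarrow>\<^sub>L 'b"
    unfolding less_eq_blinfun_def
  proof safe
    fix x :: 'a assume x: "0 \<le> x"
    have "f y \<le> h x" if y: "0 \<le> y" "y \<le> x" for y
    proof -
      have "f y \<le> h y" using y \<open>f \<le> h\<close> by (simp add: less_eq_blinfun_def)
      moreover have "0 \<le> h (x - y)" using y \<open>0 \<le> h\<close> by (simp add: less_eq_blinfun_def)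
      ultimately show ?thesis by (simp add: blinfun.diff_right)
    qed
    then show "blinfun_pos f x \<le> h x"
      using x by (simp add: blinfun_pos_apply cone_pos_least)
  qed
  fix f g h :: "'a \<Rightarrow>\<^sub>L 'b" and a b :: real
  show "(f < g) = (f \<le> g \<and> \<not> g \<le> f)" by (rule less_blinfun_def)
  show "f \<le> f" by (simp add: less_eq_blinfun_def)
  show "f \<le> h" if "f \<le> g" "g \<le> h" using that unfolding less_eq_blinfun_def by (blast intro: order.trans)
  show "f = g" if "f \<le> g" "g \<le> f"
    using that unfolding less_eq_blinfun_def by (blast intro: blinfun_ext_nonneg antisym)
  have add: "c + d \<le> c + e" if "d \<le> e" for c d e :: "'a \<Rightarrow>\<^sub>L 'b"
    using that by (simp add: less_eq_blinfun_def blinfun.add_left)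
  then show "h + f \<le> h + g" if "f \<le> g" using that .
  have le_iff: "d \<le> e \<longleftrightarrow> 0 \<le> e - d" for d e :: "'a \<Rightarrow>\<^sub>L 'b"
    by (simp add: less_eq_blinfun_def blinfun.diff_left)
  show "f \<le> sup f g" using pos_ge(1)[of "f - g"]
    by (subst le_iff, subst (asm) le_iff) (simp add: sup_blinfun_def algebra_simps)
  show "g \<le> sup f g" using pos_ge(2)[of "f - g"]
    by (subst le_iff) (simp add: sup_blinfun_def)
  show "sup g h \<le> f" if "g \<le> f" "h \<le> f"
  proof -
    have "blinfun_pos (g - h) \<le> f - h"
      using that by (intro pos_least) (simp_all add: le_iff[of "g - h"] le_iff[of g f] le_iff[of h f])
    then show ?thesis
      by (subst le_iff, subst (asm) le_iff) (simp add: sup_blinfun_def algebra_simps)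
  qed
  show "inf f g \<le> f" using pos_ge(2)[of "f - g"]
    by (subst le_iff) (simp add: inf_blinfun_def)
  show "inf f g \<le> g" using pos_ge(1)[of "f - g"]
    by (subst le_iff, subst (asm) le_iff) (simp add: inf_blinfun_def algebra_simps)
  show "f \<le> inf g h" if "f \<le> g" "f \<le> h"
  proof -
    have "blinfun_pos (g - h) \<le> g - f"
      using that
      by (intro pos_least)
        (simp_all add: le_iff[of "g - h"] le_iff[of f g] le_iff[of f h])
    then show ?thesis
      by (subst le_iff, subst (asm) le_iff) (simp add: inf_blinfun_def algebra_simps)
  qed
  show "\<bar>f\<bar> = sup f (- f)" by (rule abs_blinfun_def)
  show "a *\<^sub>R f \<le> a *\<^sub>R g" if "f \<le> g" "0 \<le> a"
    using that by (auto simp: less_eq_blinfun_def blinfun.scaleR_left intro: scaleR_left_mono)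
  show "a *\<^sub>R f \<le> b *\<^sub>R f" if "a \<le> b" "0 \<le> f"
    using that by (auto simp: less_eq_blinfun_def blinfun.scaleR_left intro: scaleR_right_mono)
  have abs_apply: "blinfun_apply \<bar>d\<bar> x = cone_pos (2 *\<^sub>R d) x - d x" if "0 \<le> x"
    for d :: "'a \<Rightarrow>\<^sub>L 'b" and x
    using that
    by (simp add: abs_blinfun_def sup_blinfun_def blinfun.add_left blinfun.minus_left blinfun.diff_left
        blinfun_pos_apply scaleR_2)
  have abs_ge: "d x \<le> blinfun_apply \<bar>d\<bar> x" "- d x \<le> blinfun_apply \<bar>d\<bar> x" if "0 \<le> x"
    for d :: "'a \<Rightarrow>\<^sub>L 'b" and x
    using that cone_pos_upper[of x x "2 *\<^sub>R d"] cone_pos_nonneg[of x "2 *\<^sub>R d"]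
    by (simp_all add: abs_apply blinfun.add_left scaleR_2 le_diff_eq)
  have abs_norm: "norm (blinfun_apply \<bar>d\<bar> u) \<le> norm d * norm u" if u: "0 \<le> u"
    for d :: "'a \<Rightarrow>\<^sub>L 'b" and u
  proof (rule norm_le_if_least[of "blinfun_apply d ` {z. \<bar>z\<bar> \<le> u}"])
    show "0 \<le> blinfun_apply \<bar>d\<bar> u"
      using abs_ge[OF u, of d] by (metis abs_ge_zero abs_leI order.trans)
    show "norm z \<le> norm d * norm u" if "z \<in> blinfun_apply d ` {z. \<bar>z\<bar> \<le> u}" for z
      using that u
      by (auto intro!: order.trans[OF norm_blinfun] mult_left_mono norm_le_if_abs_le)
    fix b assume b: "\<And>z. z \<in> blinfun_apply d ` {z. \<bar>z\<bar> \<le> u} \<Longrightarrow> z \<le> b"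
    have "cone_pos (2 *\<^sub>R d) u \<le> b + d u"
    proof (rule cone_pos_least[OF u])
      fix y assume y: "0 \<le> y" "y \<le> u"
      have "\<bar>2 *\<^sub>R y - u\<bar> \<le> u"
        using y by (intro abs_leI) (simp_all add: scaleR_2 add_mono diff_le_eq)
      then have "d (2 *\<^sub>R y - u) \<le> b" by (intro b) auto
      then show "(2 *\<^sub>R d) y \<le> b + d u"
        by (simp add: blinfun.diff_right blinfun.scaleR_right blinfun.scaleR_left diff_le_eq)
    qed
    then show "blinfun_apply \<bar>d\<bar> u \<le> b" using u by (simp add: abs_apply diff_le_eq)
  qed auto
  show "norm f \<le> norm g" if fg: "\<bar>f\<bar> \<le> \<bar>g\<bar>"
  proof (rule norm_blinfun_bound)
    fix x :: 'a
    have nn: "0 \<le> pprt x" "0 \<le> - nprt x" by auto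
    have x: "x = pprt x - (- nprt x)" using prts[of x] by simp
    have ax: "\<bar>x\<bar> = pprt x + (- nprt x)" by (simp add: abs_prts)
    have fx: "f x = f (pprt x) - f (- nprt x)" by (metis x blinfun.diff_right)
    have "blinfun_apply \<bar>f\<bar> \<bar>x\<bar> = blinfun_apply \<bar>f\<bar> (pprt x) + blinfun_apply \<bar>f\<bar> (- nprt x)"
      by (simp only: ax blinfun.add_right)
    moreover have "f x \<le> blinfun_apply \<bar>f\<bar> (pprt x) + blinfun_apply \<bar>f\<bar> (- nprt x)"
      using add_mono[OF abs_ge(1)[OF nn(1), of f] abs_ge(2)[OF nn(2), of f]]
      by (simp only: fx diff_conv_add_uminus)
    moreover have "- f x \<le> blinfun_apply \<bar>f\<bar> (pprt x) + blinfun_apply \<bar>f\<bar> (- nprt x)"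
      using add_mono[OF abs_ge(2)[OF nn(1), of f] abs_ge(1)[OF nn(2), of f]]
      by (simp only: fx minus_diff_eq) (simp add: algebra_simps)
    ultimately have "\<bar>f x\<bar> \<le> blinfun_apply \<bar>f\<bar> \<bar>x\<bar>" by (metis abs_leI)
    also have "\<dots> \<le> blinfun_apply \<bar>g\<bar> \<bar>x\<bar>" using fg by (simp add: less_eq_blinfun_def)
    finally have "norm (f x) \<le> norm (blinfun_apply \<bar>g\<bar> \<bar>x\<bar>)"
      by (intro norm_le_if_abs_le) (meson abs_ge_self order.trans)
    also have "\<dots> \<le> norm g * norm x" using abs_norm[of "\<bar>x\<bar>" g] by simp
    finally show "norm (f x) \<le> norm g * norm x" .
  qed auto
qed

end

section \<open>Operators and sequences\<close>

text \<open>
  Operators are plain functions. Boundedness is not part of \<open>regular_operator\<close> (it is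
  automatic on Banach lattices), but it is part of \<open>positively_limited\<close>, where it makes
  the adjoint well defined, and of \<open>almost_Dunford_Pettis\<close>.
\<close>

definition positive_operator :: "('a::banach_lattice \<Rightarrow> 'b::banach_lattice) \<Rightarrow> bool"
  where "positive_operator T \<longleftrightarrow> linear T \<and> (\<forall>x\<ge>0. 0 \<le> T x)"

definition regular_operator :: "('a::banach_lattice \<Rightarrow> 'b::banach_lattice) \<Rightarrow> bool"
  where "regular_operator T \<longleftrightarrow>
    (\<exists>P Q. positive_operator P \<and> positive_operator Q \<and> (\<forall>x. T x = P x - Q x))"

text \<open>The value of \<open>dual_operator T\<close> is meaningful only for bounded linear \<open>T\<close>.\<close>

definition dual_operator ::
    "('a::real_normed_vector \<Rightarrow> 'b::real_normed_vector) \<Rightarrow> ('b \<Rightarrow>\<^sub>L real) \<Rightarrow> ('a \<Rightarrow>\<^sub>L real)"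
  where "dual_operator T f = Blinfun (\<lambda>x. blinfun_apply f (T x))"

lemma dual_operator_apply:
  "bounded_linear T \<Longrightarrow> blinfun_apply (dual_operator T f) x = blinfun_apply f (T x)"
  unfolding dual_operator_def
  by (simp add: bounded_linear_Blinfun_apply bounded_linear_compose blinfun.bounded_linear_right)

definition weakly_null :: "(nat \<Rightarrow> 'a::real_normed_vector) \<Rightarrow> bool"
  where "weakly_null x \<longleftrightarrow> (\<forall>f :: 'a \<Rightarrow>\<^sub>L real. (\<lambda>n. blinfun_apply f (x n)) \<longlonglongrightarrow> 0)"

definition weak_star_null :: "(nat \<Rightarrow> 'a::real_normed_vector \<Rightarrow>\<^sub>L real) \<Rightarrow> bool"
  where "weak_star_null f \<longleftrightarrow> (\<forall>x. (\<lambda>n. blinfun_apply (f n) x) \<longlonglongrightarrow> 0)"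

definition disjoint_seq :: "(nat \<Rightarrow> 'a::banach_lattice) \<Rightarrow> bool"
  where "disjoint_seq x \<longleftrightarrow> (\<forall>m n. m \<noteq> n \<longrightarrow> inf \<bar>x m\<bar> \<bar>x n\<bar> = 0)"

definition dual_positive_Schur :: "'a::banach_lattice itself \<Rightarrow> bool"
  where "dual_positive_Schur _ \<longleftrightarrow>
    (\<forall>f :: nat \<Rightarrow> 'a \<Rightarrow>\<^sub>L real. (\<forall>n. 0 \<le> f n) \<and> weak_star_null f \<longrightarrow> f \<longlonglongrightarrow> 0)"

definition positively_limited :: "('a::banach \<Rightarrow> 'b::banach_lattice) \<Rightarrow> bool"
  where "positively_limited T \<longleftrightarrow> bounded_linear T \<and>
    (\<forall>f :: nat \<Rightarrow> 'b \<Rightarrow>\<^sub>L real. (\<forall>n. 0 \<le> f n) \<and> weak_star_null f \<longrightarrow>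
      (\<lambda>n. dual_operator T (f n)) \<longlonglongrightarrow> 0)"

definition almost_Dunford_Pettis :: "('a::banach_lattice \<Rightarrow> 'b::banach) \<Rightarrow> bool"
  where "almost_Dunford_Pettis T \<longleftrightarrow> bounded_linear T \<and>
    (\<forall>x. disjoint_seq x \<and> weakly_null x \<longrightarrow> (\<lambda>n. T (x n)) \<longlonglongrightarrow> 0)"

end

theory Submission
  imports Defs
begin

text \<open>
  Every positive operator \<open>P\<close> between Banach lattices is bounded (\<open>positive_operator_bounded\<close>),
  and its adjoint preserves both positivity and weak* convergence. So if \<open>(f\<^sub>n)\<close> is positive and
  weak*-null in \<open>F\<^sup>*\<close>, then \<open>(P\<^sup>* f\<^sub>n)\<close> is positive and weak*-null in \<open>E\<^sup>*\<close>, hence norm null by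
  the dual positive Schur property of \<open>E\<close>. Writing a regular operator as a difference of two
  positive ones shows that it is positively limited.

  For the second part let \<open>(f\<^sub>n)\<close> be disjoint and weakly null in \<open>F\<^sup>*\<close>. The point is that the
  positive parts \<open>f\<^sub>n\<^sup>+\<close> are again weak*-null; applied to \<open>(- f\<^sub>n)\<close> as well, this writes
  \<open>T\<^sup>* f\<^sub>n = T\<^sup>* f\<^sub>n\<^sup>+ - T\<^sup>* f\<^sub>n\<^sup>-\<close> as a difference of norm null sequences, because \<open>T\<close> is positively
  limited. More generally, let \<open>(x\<^sub>n)\<close> be disjoint and weakly null in a Banach lattice and let
  \<open>\<phi>\<close> be a positive functional (below: evaluation at a positive vector). By disjointness every
  \<open>x\<^sub>n\<^sup>+\<close> lies in the disjoint complement \<open>I\<close> of the set of all \<open>x\<^sub>m\<^sup>-\<close>. The component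
  of \<open>\<phi>\<close> on \<open>I\<close>, given for \<open>g \<ge> 0\<close> by \<open>\<psi> g = Sup {\<phi> v | v \<in> I, 0 \<le> v \<le> g}\<close>, is a bounded
  functional (\<open>band_component_exists\<close>) that equals \<open>\<phi>\<close> on all \<open>x\<^sub>n\<^sup>+\<close> and vanishes on all \<open>x\<^sub>n\<^sup>-\<close>.
  Hence \<open>\<phi> (x\<^sub>n\<^sup>+) = \<psi> (x\<^sub>n)\<close> tends to \<open>0\<close>: one functional \<open>\<psi>\<close>, independent of \<open>n\<close>, detects all
  positive parts, and this is what lets weak nullity be applied.
\<close>

section \<open>The positive cone of a Banach lattice\<close>

lemma diff_parts: "pprt x - (- nprt x) = (x::'a::lattice_ab_group_add_abs)"
  by (metis diff_minus_eq_add prts)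

lemma norm_parts_le:
  fixes x :: "'a::banach_lattice"
  shows "norm (pprt x) \<le> norm x" "norm (- nprt x) \<le> norm x"
proof -
  have "pprt x \<le> \<bar>x\<bar>" "- nprt x \<le> \<bar>x\<bar>" by (auto simp: abs_prts)
  then show "norm (pprt x) \<le> norm x" "norm (- nprt x) \<le> norm x"
    using norm_mono_nonneg[of "pprt x" "\<bar>x\<bar>"] norm_mono_nonneg[of "- nprt x" "\<bar>x\<bar>"] by simp_all
qed

lemma inf_pprt_neg_nprt: "inf (pprt x) (- nprt x) = (0::'a::lattice_ab_group_add_abs)"
proof -
  have "- nprt x = pprt x + - x"
    using diff_parts[of x] by (simp add: algebra_simps)
  then have "inf (pprt x) (- nprt x) = pprt x + inf 0 (- x)"
    by (simp add: add_inf_distrib_left)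
  also have "inf 0 (- x) = - pprt x"
    by (simp add: pprt_def neg_sup_eq_inf inf_commute)
  finally show ?thesis by simp
qed

text \<open>The cone is closed because \<open>(- L)\<^sup>+ \<le> \<bar>X n - L\<bar>\<close> as soon as \<open>X n \<ge> 0\<close>.\<close>

lemma nonneg_limit:
  fixes X :: "nat \<Rightarrow> 'a::banach_lattice"
  assumes lim: "X \<longlonglongrightarrow> L" and pos: "eventually (\<lambda>n. 0 \<le> X n) sequentially"
  shows "0 \<le> L"
proof -
  have "norm (pprt (- L)) \<le> norm (X n - L)" if "0 \<le> X n" for n
  proof -
    have "pprt (- L) \<le> pprt (X n - L)" using that by (intro pprt_mono) simp
    then have "norm (pprt (- L)) \<le> norm (pprt (X n - L))" by (intro norm_mono_nonneg) auto
    then show ?thesis using norm_parts_le(1)[of "X n - L"] by linarith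
  qed
  then have "eventually (\<lambda>n. norm (pprt (- L)) \<le> norm (X n - L)) sequentially"
    using pos by (auto elim: eventually_mono)
  moreover have "(\<lambda>n. norm (X n - L)) \<longlonglongrightarrow> 0"
    using lim by (simp add: LIM_zero tendsto_norm_zero)
  ultimately have "norm (pprt (- L)) \<le> 0"
    by (intro tendsto_lowerbound) auto
  then have "pprt (- L) = 0" by simp
  then have "- L \<le> 0" by (simp add: pprt_def sup.absorb_iff2)
  then show ?thesis by simp
qed

lemma term_le_suminf:
  fixes y :: "nat \<Rightarrow> 'a::banach_lattice"
  assumes "summable y" and pos: "\<And>n. 0 \<le> y n"
  shows "y n \<le> suminf y"
proof -
  have "(\<lambda>N. sum y {..<N} - y n) \<longlonglongrightarrow> suminf y - y n"
    using assms(1) by (intro tendsto_diff tendsto_const summable_LIMSEQ)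
  moreover have "0 \<le> sum y {..<N} - y n" if "n < N" for N
  proof -
    have "sum y {n} \<le> sum y {..<N}"
      using that pos by (intro sum_mono2) auto
    then show ?thesis by simp
  qed
  then have "eventually (\<lambda>N. 0 \<le> sum y {..<N} - y n) sequentially"
    by (intro eventually_mono[OF eventually_gt_at_top[of n]])
  ultimately have "0 \<le> suminf y - y n" by (rule nonneg_limit)
  then show ?thesis by simp
qed

section \<open>Positive operators\<close>

text \<open>
  If \<open>T\<close> were unbounded on the cone, there would be positive \<open>y\<^sub>n\<close> with \<open>\<parallel>y\<^sub>n\<parallel> = 2\<^sup>-\<^sup>n\<close> and
  \<open>\<parallel>T y\<^sub>n\<parallel> > 2\<^sup>n\<close>; the sum of the \<open>y\<^sub>n\<close> dominates each of them, which leaves no finite value for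
  the norm of its image.
\<close>

lemma positive_operator_bounded:
  fixes T :: "'a::banach_lattice \<Rightarrow> 'b::banach_lattice"
  assumes "positive_operator T"
  shows "bounded_linear T"
proof -
  have lin: "linear T" and pos: "\<And>x. 0 \<le> x \<Longrightarrow> 0 \<le> T x"
    using assms by (auto simp: positive_operator_def)
  have "\<exists>K\<ge>0. \<forall>x\<ge>0. norm (T x) \<le> K * norm x"
  proof (rule ccontr)
    assume unb: "\<not> ?thesis"
    have "\<exists>y\<ge>0. norm y = (1/2)^n \<and> 2^n < norm (T y)" for n :: nat
    proof -
      obtain x where x: "0 \<le> x" "4^n * norm x < norm (T x)"
        using unb by (metis not_le zero_le_power zero_le_numeral)
      have "x \<noteq> 0" using x lin by (auto simp: linear_0)
      then have nx: "0 < norm x" by simp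
      define c where "c = (1/2)^n / norm x"
      have c: "0 < c" using nx by (simp add: c_def)
      have "(1/2)^n * 4^n = (2::real)^n" by (simp flip: power_mult_distrib)
      then have "2^n = c * (4^n * norm x)" using nx by (simp add: c_def)
      also have "\<dots> < c * norm (T x)" using x c by simp
      also have "\<dots> = norm (T (c *\<^sub>R x))" using c lin by (simp add: linear_scale)
      finally have "2^n < norm (T (c *\<^sub>R x))" .
      moreover have "norm (c *\<^sub>R x) = (1/2)^n" using nx by (simp add: c_def)
      moreover have "0 \<le> c *\<^sub>R x" using c x by (intro scaleR_nonneg_nonneg) auto
      ultimately show ?thesis by blast
    qed
    then have "\<exists>y. \<forall>n. 0 \<le> y n \<and> norm (y n) = (1/2)^n \<and> 2^n < norm (T (y n))"
      by (intro choice allI) auto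
    then obtain y where y: "\<And>n. 0 \<le> y n" "\<And>n. norm (y n) = (1/2)^n" "\<And>n. 2^n < norm (T (y n))"
      by blast
    have "summable (\<lambda>n. norm (y n))" unfolding y(2) by (intro summable_geometric) simp
    then have "summable y" by (rule summable_norm_cancel)
    have "2^n < norm (T (suminf y))" for n :: nat
    proof -
      have "0 \<le> T (suminf y - y n)"
        using term_le_suminf[OF \<open>summable y\<close> y(1)] by (intro pos) simp
      then have "T (y n) \<le> T (suminf y)" using lin by (simp add: linear_diff)
      then have "norm (T (y n)) \<le> norm (T (suminf y))"
        using pos[OF y(1)] by (intro norm_mono_nonneg)
      then show ?thesis using y(3)[of n] by linarith
    qed
    moreover obtain n where "norm (T (suminf y)) < 2^n"
      using real_arch_pow[of 2 "norm (T (suminf y))"] by auto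
    ultimately show False by (meson less_asym)
  qed
  then obtain K where K: "0 \<le> K" "\<And>x. 0 \<le> x \<Longrightarrow> norm (T x) \<le> K * norm x" by blast
  have "norm (T x) \<le> norm x * (2 * K)" for x
  proof -
    have "norm (T x) = norm (T (pprt x) - T (- nprt x))"
      using lin by (metis diff_parts linear_diff)
    also have "\<dots> \<le> norm (T (pprt x)) + norm (T (- nprt x))" by (rule norm_triangle_ineq4)
    also have "\<dots> \<le> K * norm (pprt x) + K * norm (- nprt x)"
      by (intro add_mono K) auto
    also have "\<dots> \<le> K * norm x + K * norm x"
      by (intro add_mono mult_left_mono norm_parts_le K)
    finally show ?thesis by (simp add: mult_ac)
  qed
  then show ?thesis
    using lin by (intro bounded_linear_intro[of T "2 * K"]) (auto simp: linear_add linear_scale)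
qed

lemma dual_operator_diff:
  assumes "bounded_linear T"
  shows "dual_operator T (f - g) = dual_operator T f - dual_operator T g"
  by (rule blinfun_eqI) (simp add: dual_operator_apply[OF assms] blinfun.diff_left)

lemma bounded_linear_dual_operator:
  assumes T: "bounded_linear T"
  shows "bounded_linear (dual_operator T)"
proof (rule bounded_linear_intro[where K = "onorm T"])
  fix f g and r :: real
  show "dual_operator T (f + g) = dual_operator T f + dual_operator T g"
    by (rule blinfun_eqI) (simp add: dual_operator_apply[OF T] blinfun.add_left)
  show "dual_operator T (r *\<^sub>R f) = r *\<^sub>R dual_operator T f"
    by (rule blinfun_eqI) (simp add: dual_operator_apply[OF T] blinfun.scaleR_left)
  show "norm (dual_operator T f) \<le> norm f * onorm T"
  proof (rule norm_blinfun_bound)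
    fix x
    have "norm (f (T x)) \<le> norm f * norm (T x)" by (rule norm_blinfun)
    also have "\<dots> \<le> norm f * (onorm T * norm x)" by (intro mult_left_mono onorm[OF T]) auto
    finally show "norm (dual_operator T f x) \<le> norm f * onorm T * norm x"
      by (simp add: dual_operator_apply[OF T] mult.assoc)
  qed (simp add: onorm_pos_le[OF T])
qed

lemma positive_operator_positively_limited:
  fixes P :: "'a::banach_lattice \<Rightarrow> 'b::banach_lattice"
  assumes schur: "dual_positive_Schur TYPE('a)" and P: "positive_operator P"
  shows "positively_limited P"
  unfolding positively_limited_def
proof (intro conjI allI impI)
  show bP: "bounded_linear P" using P by (rule positive_operator_bounded)
  fix f :: "nat \<Rightarrow> 'b \<Rightarrow>\<^sub>L real"
  assume f: "(\<forall>n. 0 \<le> f n) \<and> weak_star_null f"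
  have "0 \<le> dual_operator P (f n)" for n
    using f P by (simp add: less_eq_blinfun_def dual_operator_apply[OF bP] positive_operator_def)
  moreover have "weak_star_null (\<lambda>n. dual_operator P (f n))"
    using f by (simp add: weak_star_null_def dual_operator_apply[OF bP])
  ultimately show "(\<lambda>n. dual_operator P (f n)) \<longlonglongrightarrow> 0"
    using schur by (simp add: dual_positive_Schur_def)
qed

lemma positively_limited_diff:
  fixes P Q :: "'a::banach \<Rightarrow> 'b::banach_lattice"
  assumes "positively_limited P" "positively_limited Q"
  shows "positively_limited (\<lambda>x. P x - Q x)"
  unfolding positively_limited_def
proof (intro conjI allI impI)
  have P: "bounded_linear P" and Q: "bounded_linear Q"
    using assms by (auto simp: positively_limited_def)
  then show D: "bounded_linear (\<lambda>x. P x - Q x)" by (rule bounded_linear_sub)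
  fix f :: "nat \<Rightarrow> 'b \<Rightarrow>\<^sub>L real"
  assume "(\<forall>n. 0 \<le> f n) \<and> weak_star_null f"
  then have "(\<lambda>n. dual_operator P (f n) - dual_operator Q (f n)) \<longlonglongrightarrow> 0 - 0"
    using assms by (intro tendsto_diff) (auto simp: positively_limited_def)
  moreover have "dual_operator (\<lambda>x. P x - Q x) g = dual_operator P g - dual_operator Q g" for g
    by (rule blinfun_eqI)
      (simp add: dual_operator_apply[OF P] dual_operator_apply[OF Q] dual_operator_apply[OF D]
        blinfun.diff_left blinfun.diff_right)
  ultimately show "(\<lambda>n. dual_operator (\<lambda>x. P x - Q x) (f n)) \<longlonglongrightarrow> 0" by simp
qed

section \<open>Components of a positive functional\<close>

text \<open>Differences of positive vectors exhaust the space, so a cone functional has one candidate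
  extension, \<open>x \<mapsto> q (x\<^sup>+) - q (x\<^sup>-)\<close>; additivity makes it independent of the decomposition.\<close>

lemma cone_functional_extends:
  fixes q :: "'a::banach_lattice \<Rightarrow> real"
  assumes add: "\<And>x y. 0 \<le> x \<Longrightarrow> 0 \<le> y \<Longrightarrow> q (x + y) = q x + q y"
    and scale: "\<And>c x. 0 < c \<Longrightarrow> 0 \<le> x \<Longrightarrow> q (c *\<^sub>R x) = c * q x"
    and bound: "\<And>x. 0 \<le> x \<Longrightarrow> \<bar>q x\<bar> \<le> C * norm x" and "0 \<le> C"
  shows "\<exists>\<psi> :: 'a \<Rightarrow>\<^sub>L real. \<forall>x\<ge>0. \<psi> x = q x"
proof -
  define P where "P x = q (pprt x) - q (- nprt x)" for x
  have P: "P (u - v) = q u - q v" if "0 \<le> u" "0 \<le> v" for u v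
  proof -
    have "pprt (u - v) + v = u + - nprt (u - v)"
      using diff_parts[of "u - v"] by (simp add: algebra_simps)
    then have "q (pprt (u - v)) + q v = q u + q (- nprt (u - v))"
      using that by (metis add neg_0_le_iff_le nprt_le_zero zero_le_pprt)
    then show ?thesis by (simp add: P_def)
  qed
  have q0: "q 0 = 0" using add[of 0 0] by simp
  have Pq: "P x = q x" if "0 \<le> x" for x using P[of x 0] that q0 by simp
  have nn: "0 \<le> pprt x" "0 \<le> - nprt x" for x :: 'a by auto
  have P_add: "P (x + y) = P x + P y" for x y
  proof -
    have "x + y = (pprt x - (- nprt x)) + (pprt y - (- nprt y))" by (simp only: diff_parts)
    then have "x + y = (pprt x + pprt y) - (- nprt x + - nprt y)" by (simp add: algebra_simps)
    then have "P (x + y) = q (pprt x + pprt y) - q (- nprt x + - nprt y)"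
      by (metis P add_nonneg_nonneg nn)
    then show ?thesis unfolding P_def add[OF nn(1) nn(1)] add[OF nn(2) nn(2)] by simp
  qed
  have P_minus: "P (- x) = - P x" for x by (simp add: P_def pprt_neg nprt_neg)
  have P_pos: "P (c *\<^sub>R x) = c * P x" if "0 < c" for c x
  proof -
    have "c *\<^sub>R x = c *\<^sub>R pprt x - c *\<^sub>R (- nprt x)"
      by (metis diff_parts scaleR_right_diff_distrib)
    then have "P (c *\<^sub>R x) = q (c *\<^sub>R pprt x) - q (c *\<^sub>R (- nprt x))"
      by (metis P nn that scaleR_nonneg_nonneg less_imp_le)
    then show ?thesis unfolding P_def scale[OF that nn(1)] scale[OF that nn(2)]
      by (simp add: right_diff_distrib)
  qed
  have P_scale: "P (c *\<^sub>R x) = c *\<^sub>R P x" for c x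
  proof (cases c "0::real" rule: linorder_cases)
    case less
    then have "P ((- c) *\<^sub>R x) = (- c) * P x" by (intro P_pos) auto
    then show ?thesis by (simp add: P_minus)
  qed (use q0 Pq in \<open>auto simp: P_pos\<close>)
  have "norm (P x) \<le> norm x * (2 * C)" for x
  proof -
    have "\<bar>P x\<bar> \<le> C * norm (pprt x) + C * norm (- nprt x)"
      using bound[OF nn(1), of x] bound[OF nn(2), of x] unfolding P_def by linarith
    also have "\<dots> \<le> C * norm x + C * norm x"
      using \<open>0 \<le> C\<close> by (intro add_mono mult_left_mono norm_parts_le)
    finally show ?thesis by (simp add: mult_ac)
  qed
  then have "bounded_linear P" using P_add P_scale by (intro bounded_linear_intro)
  then show ?thesis using Pq by (intro exI[of _ "Blinfun P"]) (simp add: bounded_linear_Blinfun_apply)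
qed

text \<open>
  For the additivity of \<open>Sup {\<phi> v | v \<in> I, v \<le> x}\<close> in \<open>x\<close>, an element \<open>v \<in> I\<close> below \<open>x + y\<close> is split
  as \<open>inf v x + (v - inf v x)\<close>; solidity keeps both parts in \<open>I\<close>.
\<close>

lemma band_component_exists:
  fixes \<phi> :: "'a::banach_lattice \<Rightarrow>\<^sub>L real" and I :: "'a set"
  assumes \<phi>: "0 \<le> \<phi>"
    and I_pos: "\<And>v. v \<in> I \<Longrightarrow> 0 \<le> v" and I_0: "0 \<in> I"
    and I_solid: "\<And>v w. w \<in> I \<Longrightarrow> 0 \<le> v \<Longrightarrow> v \<le> w \<Longrightarrow> v \<in> I"
    and I_add: "\<And>v w. v \<in> I \<Longrightarrow> w \<in> I \<Longrightarrow> v + w \<in> I"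
    and I_scale: "\<And>c v. 0 < c \<Longrightarrow> v \<in> I \<Longrightarrow> c *\<^sub>R v \<in> I"
  shows "\<exists>\<psi> :: 'a \<Rightarrow>\<^sub>L real. \<forall>x\<ge>0. \<psi> x = Sup (\<phi> ` {v \<in> I. v \<le> x})"
proof -
  define q where "q x = Sup (\<phi> ` {v \<in> I. v \<le> x})" for x
  have \<phi>_mono: "\<phi> v \<le> \<phi> w" if "v \<le> w" for v w
  proof -
    have "0 \<le> \<phi> (w - v)" using \<phi> that by (simp add: less_eq_blinfun_def)
    then show ?thesis by (simp add: blinfun.diff_right)
  qed
  have upper: "\<phi> v \<le> q x" if "v \<in> I" "v \<le> x" for v x
    unfolding q_def using that by (intro cSup_upper bdd_aboveI[of _ "\<phi> x"]) (auto intro: \<phi>_mono)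
  have least: "q x \<le> b" if "0 \<le> x" "\<And>v. v \<in> I \<Longrightarrow> v \<le> x \<Longrightarrow> \<phi> v \<le> b" for x b
    unfolding q_def using that I_0 by (intro cSup_least) auto
  have q_add: "q (x + y) = q x + q y" if x: "0 \<le> x" and y: "0 \<le> y" for x y
  proof (rule antisym)
    show "q (x + y) \<le> q x + q y"
    proof (rule least)
      fix v assume v: "v \<in> I" "v \<le> x + y"
      define u where "u = inf v x"
      have u: "0 \<le> u" "u \<le> v" "u \<le> x" using x I_pos[OF v(1)] by (auto simp: u_def)
      have "v - u = v + sup (- v) (- x)"
        by (simp add: u_def diff_conv_add_uminus neg_inf_eq_sup)
      also have "\<dots> = sup 0 (v - x)" by (simp add: add_sup_distrib_left)
      also have "\<dots> \<le> y" using y v by (simp add: diff_le_eq add.commute)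
      finally have "\<phi> (v - u) \<le> q y" using u v by (intro upper I_solid[OF v(1)]) auto
      moreover have "\<phi> u \<le> q x" using u v by (intro upper I_solid[OF v(1)]) auto
      ultimately show "\<phi> v \<le> q x + q y" by (simp add: blinfun.diff_right)
    qed (use x y in auto)
  next
    have sum: "\<phi> v + \<phi> w \<le> q (x + y)" if "v \<in> I" "v \<le> x" "w \<in> I" "w \<le> y" for v w
      using that upper[OF I_add[of v w], of "x + y"] by (simp add: blinfun.add_right add_mono)
    have "q x \<le> q (x + y) - \<phi> w" if "w \<in> I" "w \<le> y" for w
      using that x sum by (intro least) (auto simp: le_diff_eq)
    then have "q y \<le> q (x + y) - q x"
      using y by (intro least) (auto simp: algebra_simps)
    then show "q x + q y \<le> q (x + y)" by simp
  qed
  have scale_le: "c * q x \<le> q (c *\<^sub>R x)" if c: "0 < c" and x: "0 \<le> x" for c x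
  proof -
    have "q x \<le> q (c *\<^sub>R x) / c"
    proof (rule least[OF x])
      fix v assume v: "v \<in> I" "v \<le> x"
      then have "\<phi> (c *\<^sub>R v) \<le> q (c *\<^sub>R x)"
        using c by (intro upper I_scale scaleR_left_mono) auto
      then show "\<phi> v \<le> q (c *\<^sub>R x) / c" using c by (simp add: blinfun.scaleR_right field_simps)
    qed
    then show ?thesis using c by (simp add: field_simps)
  qed
  have q_scale: "q (c *\<^sub>R x) = c * q x" if c: "0 < c" and x: "0 \<le> x" for c x
  proof (rule antisym)
    have "inverse c * q (c *\<^sub>R x) \<le> q (inverse c *\<^sub>R (c *\<^sub>R x))"
      using c x by (intro scale_le scaleR_nonneg_nonneg) auto
    then show "q (c *\<^sub>R x) \<le> c * q x" using c by (simp add: field_simps)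
  qed (rule scale_le[OF c x])
  have q_bound: "\<bar>q x\<bar> \<le> norm \<phi> * norm x" if x: "0 \<le> x" for x
  proof -
    have "0 \<le> q x" using upper[OF I_0 x] by (simp add: blinfun.zero_right)
    moreover have "q x \<le> \<phi> x" using x by (intro least \<phi>_mono)
    moreover have "\<phi> x \<le> norm \<phi> * norm x" using norm_blinfun[of \<phi> x] by simp
    ultimately show ?thesis by linarith
  qed
  show ?thesis
    using cone_functional_extends[of q "norm \<phi>", OF q_add q_scale q_bound] by (simp add: q_def)
qed

section \<open>Disjoint weakly null sequences\<close>

definition disjoint_cone :: "'a::banach_lattice set \<Rightarrow> 'a set"
  where "disjoint_cone D = {v. 0 \<le> v \<and> (\<forall>d\<in>D. inf v d = 0)}"

lemma disjoint_coneI: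
  assumes "0 \<le> v" "\<And>d. d \<in> D \<Longrightarrow> 0 \<le> d" "\<And>d. d \<in> D \<Longrightarrow> inf v d \<le> 0"
  shows "v \<in> disjoint_cone D"
  using assms by (auto simp: disjoint_cone_def intro!: antisym)

lemma disjoint_cone_add:
  assumes D: "\<And>d. d \<in> D \<Longrightarrow> 0 \<le> d" and v: "v \<in> disjoint_cone D" and w: "w \<in> disjoint_cone D"
  shows "v + w \<in> disjoint_cone D"
proof (rule disjoint_coneI)
  show "0 \<le> v + w" using v w by (simp add: disjoint_cone_def)
  fix d assume d: "d \<in> D"
  then show "0 \<le> d" by (rule D)
  have v0: "0 \<le> v" "inf v d = 0" and w0: "inf w d = 0" using v w d by (auto simp: disjoint_cone_def)
  define z where "z = inf (v + w) d"
  have "z \<le> v + w" "z \<le> d" by (auto simp: z_def)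
  then have "z - v \<le> inf w d"
    using v0(1) by (auto simp: algebra_simps intro: order.trans add_increasing)
  then have "z \<le> v" using w0 by simp
  then have "z \<le> inf v d" using \<open>z \<le> d\<close> by simp
  then show "inf (v + w) d \<le> 0" using v0 by (simp add: z_def)
qed

lemma disjoint_cone_scale:
  assumes D: "\<And>d. d \<in> D \<Longrightarrow> 0 \<le> d" and c: "0 < c" and v: "v \<in> disjoint_cone D"
  shows "c *\<^sub>R v \<in> disjoint_cone D"
proof (rule disjoint_coneI)
  show "0 \<le> c *\<^sub>R v" using v c by (simp add: disjoint_cone_def scaleR_nonneg_nonneg)
  fix d assume d: "d \<in> D"
  then show d0: "0 \<le> d" by (rule D)
  have v0: "0 \<le> v" "inf v d = 0" using v d by (auto simp: disjoint_cone_def)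
  \<comment> \<open>A factor \<open>m \<ge> 1\<close> can be moved across the infimum: \<open>inf (m v) d \<le> m (inf v d)\<close>.\<close>
  define m where "m = max c 1"
  define z where "z = inf (c *\<^sub>R v) d"
  have m: "0 < m" "1 \<le> m" "c \<le> m" by (auto simp: m_def)
  have "z \<le> m *\<^sub>R v" using m v0 scaleR_right_mono[of c m v] by (auto simp: z_def intro: le_infI1)
  moreover have "z \<le> m *\<^sub>R d" using m d0 scaleR_right_mono[of 1 m d] by (auto simp: z_def intro: le_infI2)
  ultimately have "inverse m *\<^sub>R z \<le> inf v d"
    using m scaleR_left_mono[of z "m *\<^sub>R v" "inverse m"] scaleR_left_mono[of z "m *\<^sub>R d" "inverse m"]
    by simp
  then have "m *\<^sub>R (inverse m *\<^sub>R z) \<le> m *\<^sub>R 0" using m v0 by (intro scaleR_left_mono) auto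
  then show "inf (c *\<^sub>R v) d \<le> 0" using m by (simp add: z_def)
qed

lemma pprt_disjoint_nprt:
  assumes "disjoint_seq x"
  shows "inf (pprt (x n)) (- nprt (x m)) = 0"
proof (cases "m = n")
  case False
  have "inf (pprt (x n)) (- nprt (x m)) \<le> inf \<bar>x n\<bar> \<bar>x m\<bar>"
    by (intro inf_mono) (auto simp: abs_prts)
  also have "\<dots> = 0" using assms False by (auto simp: disjoint_seq_def)
  finally show ?thesis by (intro antisym) auto
qed (simp add: inf_pprt_neg_nprt)

text \<open>
  The component \<open>\<psi>\<close> of \<open>\<phi>\<close> on the disjoint complement of all negative parts satisfies
  \<open>\<psi> (x\<^sub>n) = \<phi> (x\<^sub>n\<^sup>+)\<close>: among the elements of that complement below \<open>x\<^sub>n\<^sup>+\<close> the largest is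
  \<open>x\<^sub>n\<^sup>+\<close> itself, and \<open>0\<close> is the only one below \<open>x\<^sub>n\<^sup>-\<close>.
\<close>

lemma disjoint_weakly_null_pprt:
  fixes x :: "nat \<Rightarrow> 'a::banach_lattice" and \<phi> :: "'a \<Rightarrow>\<^sub>L real"
  assumes disj: "disjoint_seq x" and null: "weakly_null x" and \<phi>: "0 \<le> \<phi>"
  shows "(\<lambda>n. \<phi> (pprt (x n))) \<longlonglongrightarrow> 0"
proof -
  define D where "D = range (\<lambda>m. - nprt (x m))"
  have D: "0 \<le> d" if "d \<in> D" for d using that by (auto simp: D_def)
  define I where "I = disjoint_cone D"
  have "\<exists>\<psi> :: 'a \<Rightarrow>\<^sub>L real. \<forall>y\<ge>0. \<psi> y = Sup (\<phi> ` {v \<in> I. v \<le> y})"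
  proof (rule band_component_exists[OF \<phi>])
    show "0 \<in> I" using D by (auto simp: I_def disjoint_cone_def inf_absorb1)
    show "v \<in> I" if "w \<in> I" "0 \<le> v" "v \<le> w" for v w
      unfolding I_def
    proof (rule disjoint_coneI[OF that(2) D])
      fix d assume "d \<in> D"
      then have "inf w d = 0" using that by (simp add: I_def disjoint_cone_def)
      then show "inf v d \<le> 0" using inf_mono[OF that(3) order.refl, of d] by simp
    qed
    show "0 \<le> v" if "v \<in> I" for v using that by (simp add: I_def disjoint_cone_def)
  qed (use D in \<open>auto simp: I_def intro: disjoint_cone_add disjoint_cone_scale\<close>)
  then obtain \<psi> :: "'a \<Rightarrow>\<^sub>L real" where \<psi>: "\<And>y. 0 \<le> y \<Longrightarrow> \<psi> y = Sup (\<phi> ` {v \<in> I. v \<le> y})"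
    by blast
  have "\<psi> (x n) = \<phi> (pprt (x n))" for n
  proof -
    have mem: "pprt (x n) \<in> I"
      using pprt_disjoint_nprt[OF disj] by (auto simp: I_def disjoint_cone_def D_def)
    have mono: "\<phi> v \<le> \<phi> (pprt (x n))" if "v \<le> pprt (x n)" for v
    proof -
      have "0 \<le> \<phi> (pprt (x n) - v)" using \<phi> that by (simp add: less_eq_blinfun_def)
      then show ?thesis by (simp add: blinfun.diff_right)
    qed
    have "\<psi> (pprt (x n)) = \<phi> (pprt (x n))"
      unfolding \<psi>[OF zero_le_pprt] using mem mono by (intro cSup_eq_maximum) auto
    moreover have "{v \<in> I. v \<le> - nprt (x n)} = {0}"
    proof -
      have "v = 0" if v: "v \<in> I" "v \<le> - nprt (x n)" for v
      proof -
        have "v = inf v (- nprt (x n))" using v(2) by (simp add: inf_absorb1)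
        also have "\<dots> = 0" using v(1) by (auto simp: I_def disjoint_cone_def D_def)
        finally show ?thesis .
      qed
      moreover have "0 \<in> I" using D by (auto simp: I_def disjoint_cone_def inf_absorb1)
      ultimately show ?thesis by auto
    qed
    then have "\<psi> (- nprt (x n)) = 0" by (simp add: \<psi> blinfun.zero_right del: blinfun.minus_right)
    ultimately have "\<psi> (pprt (x n) - (- nprt (x n))) = \<phi> (pprt (x n))"
      by (simp only: blinfun.diff_right)
    then show ?thesis by (simp only: diff_parts)
  qed
  moreover have "(\<lambda>n. \<psi> (x n)) \<longlonglongrightarrow> 0" using null by (simp add: weakly_null_def)
  ultimately show ?thesis by simp
qed

section \<open>Adjoints of positively limited operators\<close>

text \<open>Evaluations at positive vectors are positive functionals on the dual, and every vector is a
  difference of positive ones.\<close>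

lemma disjoint_weakly_null_pprt_weak_star:
  fixes f :: "nat \<Rightarrow> 'a::banach_lattice \<Rightarrow>\<^sub>L real"
  assumes "disjoint_seq f" "weakly_null f"
  shows "weak_star_null (\<lambda>n. pprt (f n))"
  unfolding weak_star_null_def
proof
  have pos: "(\<lambda>n. pprt (f n) y) \<longlonglongrightarrow> 0" if y: "0 \<le> y" for y
  proof -
    define ev where "ev = Blinfun (\<lambda>g :: 'a \<Rightarrow>\<^sub>L real. g y)"
    have ev: "ev g = g y" for g
      unfolding ev_def by (simp add: bounded_linear_Blinfun_apply blinfun.bounded_linear_left)
    have "0 \<le> ev" using y by (simp add: less_eq_blinfun_def ev)
    from disjoint_weakly_null_pprt[OF assms this] show ?thesis by (simp add: ev)
  qed
  fix x :: 'a
  have "(\<lambda>n. pprt (f n) (pprt x) - pprt (f n) (- nprt x)) \<longlonglongrightarrow> 0 - 0"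
    by (intro tendsto_diff pos) auto
  then have "(\<lambda>n. pprt (f n) (pprt x - (- nprt x))) \<longlonglongrightarrow> 0"
    by (simp only: blinfun.diff_right diff_zero)
  then show "(\<lambda>n. pprt (f n) x) \<longlonglongrightarrow> 0" by (simp only: diff_parts)
qed

lemma positively_limited_imp_dual_almost_Dunford_Pettis:
  fixes T :: "'a::banach \<Rightarrow> 'b::banach_lattice"
  assumes T: "positively_limited T"
  shows "almost_Dunford_Pettis (dual_operator T)"
  unfolding almost_Dunford_Pettis_def
proof (intro conjI allI impI)
  have bT: "bounded_linear T" using T by (simp add: positively_limited_def)
  then show "bounded_linear (dual_operator T)" by (rule bounded_linear_dual_operator)
  fix f :: "nat \<Rightarrow> 'b \<Rightarrow>\<^sub>L real"
  assume f: "disjoint_seq f \<and> weakly_null f"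
  then have g: "disjoint_seq (\<lambda>n. - f n)" "weakly_null (\<lambda>n. - f n)"
    by (auto simp: disjoint_seq_def weakly_null_def blinfun.minus_right
        intro: tendsto_minus[where a = 0, simplified])
  have lim: "(\<lambda>n. dual_operator T (pprt (h n))) \<longlonglongrightarrow> 0" if "disjoint_seq h" "weakly_null h" for h
    using T disjoint_weakly_null_pprt_weak_star[OF that] by (simp add: positively_limited_def)
  have "(\<lambda>n. dual_operator T (pprt (f n)) - dual_operator T (pprt (- f n))) \<longlonglongrightarrow> 0 - 0"
    using f g by (intro tendsto_diff lim) auto
  then show "(\<lambda>n. dual_operator T (f n)) \<longlonglongrightarrow> 0"
    by (simp only: dual_operator_diff[OF bT, symmetric] pprt_neg diff_parts diff_zero)
qed

theorem proposition4p3: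
  fixes T :: "'e::banach_lattice \<Rightarrow> 'f::banach_lattice"
  assumes "dual_positive_Schur TYPE('e)"
    and "regular_operator T"
  shows "positively_limited T \<and> almost_Dunford_Pettis (dual_operator T)"
proof -
  obtain P Q where P: "positive_operator P" and Q: "positive_operator Q"
    and T: "T = (\<lambda>x. P x - Q x)"
    using assms(2) unfolding regular_operator_def by blast
  have "positively_limited T"
    unfolding T using assms(1) P Q
    by (intro positively_limited_diff positive_operator_positively_limited)
  then show ?thesis by (simp add: positively_limited_imp_dual_almost_Dunford_Pettis)
qed

end
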